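(* Let $n$ be a positive integer, let $k \in \{1,\ldots,n-1\}$, and let $\mathcal{A} \subseteq \mathcal{P}([n])$ be antipodal with $|\mathcal{A}| = 2^k$. Let $\mathcal{S}_{k-1} := \{x \subseteq [n] : x \subseteq [k-1]\}$. Then $$|\partial \mathcal{A}| \geq \left|\partial\left(\mathcal{S}_{k-1} \cup \overline{\mathcal{S}_{k-1}}\right)\right|.$$
   Context: For a nonnegative integer $m$, $[m] := \{1,2,\ldots,m\}$ (with $[0] = \emptyset$), and $\mathcal{P}([n])$ is the power set of $[n]$. $Q_n$ is the discrete cube graph: its vertex set is $\mathcal{P}([n])$, and $x,y$ are joined by an edge iff $|x \Delta y| = 1$. For $\mathcal{A} \subseteq \mathcal{P}([n])$, the edge-boundary $\partial \mathcal{A}$ is the set of edges of $Q_n$ joining a vertex in $\mathcal{A}$ to a vertex not in $\mathcal{A}$. For $x \subseteq [n]$, $\overline{x} := [n] \setminus x$, and for $\mathcal{A} \subseteq \mathcal{P}([n])$, $\overline{\mathcal{A}} := \{\overline{x} : x \in \mathcal{A}\}$. A family $\mathcal{A}$ is antipodal if $\mathcal{A} = \overline{\mathcal{A}}$. *)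

theory Defs
  imports Main
begin

definition cube_vertices :: "nat \<Rightarrow> nat set set" where
  "cube_vertices n = Pow {1..n}"

definition cube_edges :: "nat \<Rightarrow> nat set set set" where
  "cube_edges n =
     {{x, y} | x y. x \<in> cube_vertices n \<and> y \<in> cube_vertices n \<and> card (sym_diff x y) = 1}"

definition edge_boundary :: "nat \<Rightarrow> nat set set \<Rightarrow> nat set set set" where
  "edge_boundary n A = {e \<in> cube_edges n. \<exists>x y. e = {x, y} \<and> x \<in> A \<and> y \<notin> A}"

definition antipode :: "nat \<Rightarrow> nat set \<Rightarrow> nat set" where
  "antipode n x = {1..n} - x"

definition antipodal :: "nat \<Rightarrow> nat set set \<Rightarrow> bool" where
  "antipodal n A \<longleftrightarrow> A = antipode n ` A"

definition subcube :: "nat \<Rightarrow> nat \<Rightarrow> nat set set" where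
  "subcube n j = {x. x \<subseteq> {1..n} \<and> x \<subseteq> {1..j}}"

end

(*
Split an antipodal family A along one coordinate: its lower half B lies in a cube Q_V with
|V| = n - 1, and the upper half is the image of B under the antipodal map. Hence twice the number
of internal edges of A equals 2 F(B), where F(B) is the degree sum of B in the folded cube, that is,
Q_V together with the antipodal matching. It therefore suffices to show F(B) <= |B| log2 |B|
whenever |B| <= 2^(|V| - 1).

This is proved by induction on |V|. Let P and Q, |P| <= |Q|, be the two halves of B along a new
coordinate, N = 2^|V| for the smaller V, and let c count the points whose antipode is also present.
Counting the edges between P and Q gives both F(B) <= F(P) + F(Q) + 2|P| and
F(B) <= F(P) + F(Q) - c(Q) + 4|P|. If |Q| <= N/2, the first bound and the entropy inequality
x log2 x + y log2 y + 2 min x y <= (x + y) log2 (x + y) suffice. If |Q| > N/2, then F(Q) is computed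
from the complement of Q (the folded cube is regular), c(Q) >= 2|Q| - N, and the minimum of the
two bounds is controlled by the inequality xlog_large_part.
*)
theory Submission
  imports Defs "HOL-Real_Asymp.Real_Asymp"
begin

section \<open>Inequalities for $x \log_2 x$\<close>

text \<open>A negative value at \<open>m\<close> would, by the mean value theorem on both sides,
  force a negative slope before a positive one, against concavity. This reduces the inequalities
  below to endpoint checks; mere continuity at the ends admits 0, where \<open>xlog\<close> has no
  derivative.\<close>

lemma nonneg_of_deriv_antimono:
  fixes f f' :: "real \<Rightarrow> real"
  assumes cont: "continuous_on {a..b} f"
    and deriv: "\<And>x. a < x \<Longrightarrow> x < b \<Longrightarrow> (f has_real_derivative f' x) (at x)"
    and anti: "\<And>x y. a < x \<Longrightarrow> x \<le> y \<Longrightarrow> y < b \<Longrightarrow> f' y \<le> f' x"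
    and ends: "0 \<le> f a" "0 \<le> f b"
    and m: "a \<le> m" "m \<le> b"
  shows "0 \<le> f m"
proof (rule ccontr)
  assume "\<not> 0 \<le> f m"
  then have neg: "f m < 0" by simp
  with ends m have "a < m" "m < b" by (auto simp: less_le)
  have "continuous_on {a..m} f" "continuous_on {m..b} f"
    using m by (auto intro: continuous_on_subset[OF cont])
  moreover have "f differentiable (at x)" if "a < x" "x < b" for x
    using deriv[OF that] by (auto simp: real_differentiable_def)
  ultimately obtain l z l' z' where
    z: "a < z" "z < m" "DERIV f z :> l" "f m - f a = (m - a) * l" and
    z': "m < z'" "z' < b" "DERIV f z' :> l'" "f b - f m = (b - m) * l'"
    using MVT[OF \<open>a < m\<close>, of f] MVT[OF \<open>m < b\<close>, of f] \<open>a < m\<close> \<open>m < b\<close>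
    by (smt (verit))
  have "l = f' z" using z \<open>m < b\<close> by (intro DERIV_unique[OF z(3)] deriv) auto
  moreover have "l' = f' z'" using z' \<open>a < m\<close> by (intro DERIV_unique[OF z'(3)] deriv) auto
  ultimately have "l' \<le> l" using anti[of z z'] z z' by auto
  moreover have "(m - a) * l < 0" using z(4) neg ends by linarith
  then have "l < 0" using \<open>a < m\<close> by (simp add: mult_less_0_iff)
  moreover have "(b - m) * l' > 0" using z'(4) neg ends by linarith
  then have "l' > 0" using \<open>m < b\<close> by (simp add: zero_less_mult_iff)
  ultimately show False by linarith
qed

text \<open>The factor \<open>x\<close> makes the value at 0 equal to 0, which is the continuous
  extension.\<close>

definition xlog :: "real \<Rightarrow> real" where
  "xlog x = x * log 2 x"

lemma xlog_simps [simp]: "xlog 0 = 0" "xlog 1 = 0" "xlog (1/2) = -1/2" "xlog (1/4) = -1/2"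
proof -
  have "log 2 (1/4::real) = - log 2 (2 ^ 2)" by (simp add: log_divide)
  also have "\<dots> = -2" by (subst log_pow_cancel) auto
  finally show "xlog (1/4) = -1/2" by (simp add: xlog_def)
qed (simp_all add: xlog_def log_divide)

lemma xlog_mult: "x \<ge> 0 \<Longrightarrow> y > 0 \<Longrightarrow> xlog (y * x) = y * xlog x + x * xlog y"
  by (cases "x = 0") (auto simp: xlog_def log_mult algebra_simps)

lemma DERIV_xlog:
  assumes "(g has_real_derivative d) (at x)" "g x > 0"
  shows "((\<lambda>x. xlog (g x)) has_real_derivative (log 2 (g x) + 1 / ln 2) * d) (at x)"
proof -
  have "(xlog has_real_derivative log 2 (g x) + 1 / ln 2) (at (g x))"
    unfolding xlog_def[abs_def] using assms(2)
    by (auto intro!: derivative_eq_intros simp: log_def field_simps)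
  from DERIV_chain2[OF this assms(1)] show ?thesis .
qed

lemma continuous_on_xlog: "continuous_on {0..} xlog"
proof -
  have "continuous (at x within {0..}) xlog" if "x \<ge> 0" for x
  proof (cases "x = 0")
    case True
    have "((\<lambda>x::real. x * ln x) \<longlongrightarrow> 0) (at_right 0)"
      by real_asymp
    then have "((\<lambda>x::real. (x * ln x) / ln 2) \<longlongrightarrow> 0) (at_right 0)"
      using tendsto_divide_zero by blast
    then have "(xlog \<longlongrightarrow> 0) (at_right 0)"
      by (simp add: xlog_def[abs_def] log_def)
    then show ?thesis using True
      by (simp add: continuous_within at_within_Ici_at_right)
  next
    case False
    then have "isCont (\<lambda>x. xlog x) x" using that
      by (intro DERIV_isCont[OF DERIV_xlog[OF DERIV_ident]]) auto
    then show ?thesis by (simp add: continuous_at_imp_continuous_at_within)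
  qed
  then show ?thesis by (simp add: continuous_on_eq_continuous_within)
qed

lemmas continuous_on_xlog' [continuous_intros] =
  continuous_on_compose2[OF continuous_on_xlog, simplified]

text \<open>For fixed \<open>y\<close> the difference of the two sides is concave in
  \<open>x\<close> on \<open>[0, y]\<close> and vanishes at both ends.\<close>

lemma xlog_add_ge:
  assumes "0 \<le> x" "x \<le> y"
  shows "xlog x + xlog y + 2 * x \<le> xlog (x + y)"
proof (cases "y = 0")
  case False
  define f where "f x = xlog (x + y) - xlog x - xlog y - 2 * x" for x
  have "0 \<le> f x"
  proof (rule nonneg_of_deriv_antimono[where f = f and a = 0 and b = y
          and f' = "\<lambda>x. log 2 (x + y) - log 2 x - 2"])
    show "continuous_on {0..y} f"
      unfolding f_def by (intro continuous_intros) (use assms in auto)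
    show "(f has_real_derivative log 2 (x + y) - log 2 x - 2) (at x)" if "0 < x" "x < y" for x
      unfolding f_def using that
      by (auto intro!: derivative_eq_intros DERIV_xlog)
    show "log 2 (w + y) - log 2 w - 2 \<le> log 2 (v + y) - log 2 v - 2" if "0 < v" "v \<le> w" "w < y" for v w
    proof -
      have "log 2 ((w + y) / w) \<le> log 2 ((v + y) / v)"
        using that by (subst log_le_cancel_iff) (auto simp: field_simps)
      then show ?thesis using that by (simp add: log_divide)
    qed
    have "f y = xlog (2 * y) - 2 * xlog y - 2 * y" by (simp add: f_def)
    then show "0 \<le> f y" using xlog_mult[of y 2] assms False by (simp add: xlog_def)
    show "0 \<le> f 0" by (simp add: f_def)
  qed (use assms in auto)
  then show ?thesis by (simp add: f_def)
qed (use assms in auto)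

text \<open>The difference is concave because \<open>t * (1 - t)\<close> increases on
  \<open>[0, 1/2]\<close>, and it vanishes at both ends. This is the case \<open>u = 0\<close> of
  \<open>xlog_large_part\<close>.\<close>

lemma xlog_le_xlog_one_minus:
  assumes "0 \<le> t" "t \<le> 1/2"
  shows "xlog t \<le> xlog (1 - t)"
proof -
  define f where "f t = xlog (1 - t) - xlog t" for t
  have "0 \<le> f t"
  proof (rule nonneg_of_deriv_antimono[where f = f and a = 0 and b = "1/2"
          and f' = "\<lambda>t. - log 2 (1 - t) - log 2 t - 2 / ln 2"])
    show "continuous_on {0..1/2} f"
      unfolding f_def by (intro continuous_intros) auto
    show "(f has_real_derivative - log 2 (1 - x) - log 2 x - 2 / ln 2) (at x)"
      if "0 < x" "x < 1/2" for x
      unfolding f_def using that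
      by (auto intro!: derivative_eq_intros DERIV_xlog)
    show "- log 2 (1 - w) - log 2 w - 2 / ln 2 \<le> - log 2 (1 - v) - log 2 v - 2 / ln 2"
      if "0 < v" "v \<le> w" "w < 1/2" for v w
    proof -
      have "0 \<le> (w - v) * (1 - v - w)" using that by (intro mult_nonneg_nonneg) auto
      then have "(1 - v) * v \<le> (1 - w) * w" by (simp add: algebra_simps)
      then have "log 2 ((1 - v) * v) \<le> log 2 ((1 - w) * w)"
        using that by (subst log_le_cancel_iff) auto
      then show ?thesis using that by (simp add: log_mult)
    qed
  qed (use assms in \<open>auto simp: f_def\<close>)
  then show ?thesis by (simp add: f_def)
qed

text \<open>\<open>xlog\<close> is convex and takes the value -1/2 at both 1/4 and 1/2.\<close>

lemma xlog_le_neg_half: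
  assumes "1/4 \<le> t" "t \<le> 1/2"
  shows "xlog t \<le> - 1/2"
proof -
  have "0 \<le> - 1/2 - xlog t"
  proof (rule nonneg_of_deriv_antimono[where f = "\<lambda>t. - 1/2 - xlog t" and a = "1/4" and b = "1/2"
          and f' = "\<lambda>t. - (log 2 t + 1 / ln 2)"])
    show "continuous_on {1/4..1/2} (\<lambda>t. - 1/2 - xlog t)"
      by (intro continuous_intros) auto
  qed (use assms in \<open>auto intro!: derivative_eq_intros DERIV_xlog\<close>)
  then show ?thesis by simp
qed

text \<open>This is \<open>xlog_large_part\<close> on the line \<open>u + t = 1/2\<close>, with
  \<open>s = u\<close>. The difference is concave, with equality at \<open>s = 0\<close> and
  \<open>s = 1/4\<close>.\<close>

lemma xlog_add_half_le:
  assumes "0 \<le> s" "s \<le> 1/4"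
  shows "xlog s + xlog (1/2 - s) + 4 * s \<le> xlog (1/2 + 2 * s)"
proof -
  define f where "f s = xlog (1/2 + 2 * s) - xlog s - xlog (1/2 - s) - 4 * s" for s
  define g where "g s = 2 * log 2 (1/2 + 2 * s) - log 2 s + log 2 (1/2 - s)" for s :: real
  \<comment> \<open>Merging the logarithms into one leaves an argument each of whose terms is
    nonincreasing in \<open>s\<close>, so \<open>g\<close> is antitone.\<close>
  have g: "g s = log 2 (1 / (8 * s) + 3/4 - 4 * s\<^sup>2)" if "0 < s" "s < 1/4" for s
  proof -
    have "g s = log 2 ((1/2 + 2 * s)\<^sup>2 * (1/2 - s) / s)"
      using that by (simp add: g_def log_mult log_divide log_nat_power)
    also have "(1/2 + 2 * s)\<^sup>2 * (1/2 - s) / s = 1 / (8 * s) + 3/4 - 4 * s\<^sup>2"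
      using that by (simp add: field_simps power2_eq_square)
    finally show ?thesis .
  qed
  have "0 \<le> f s"
  proof (rule nonneg_of_deriv_antimono[where f = f and a = 0 and b = "1/4"
          and f' = "\<lambda>s. g s + 2 / ln 2 - 4"])
    show "continuous_on {0..1/4} f"
      unfolding f_def by (intro continuous_intros) auto
    show "(f has_real_derivative g x + 2 / ln 2 - 4) (at x)"
      if "0 < x" "x < 1/4" for x
      unfolding f_def g_def using that
      by (auto intro!: derivative_eq_intros DERIV_xlog simp: algebra_simps)
    show "g w + 2 / ln 2 - 4 \<le> g v + 2 / ln 2 - 4"
      if "0 < v" "v \<le> w" "w < 1/4" for v w
    proof -
      have "1 / (8 * w) \<le> 1 / (8 * v)" "v\<^sup>2 \<le> w\<^sup>2"
        using that by (auto simp: frac_le intro: power_mono)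
      moreover have "w\<^sup>2 \<le> (1/4)\<^sup>2" using that by (intro power_mono) auto
      then have "4 * w\<^sup>2 < 3/4" by (simp add: power2_eq_square)
      moreover have "1 / (8 * w) > 0" using that by simp
      ultimately have "log 2 (1 / (8 * w) + 3/4 - 4 * w\<^sup>2) \<le> log 2 (1 / (8 * v) + 3/4 - 4 * v\<^sup>2)"
        by (subst log_le_cancel_iff) linarith+
      then show ?thesis using that by (simp add: g)
    qed
    show "0 \<le> f 0" by (simp add: f_def)
    show "0 \<le> f (1/4)" by (simp add: f_def)
  qed (use assms in auto)
  then show ?thesis by (simp add: f_def)
qed

text \<open>\<open>xlog (c + u) - xlog u\<close> is concave in \<open>u\<close>, since its
  derivative \<open>log 2 ((c + u) / u)\<close> decreases. An affine lower bound therefore only has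
  to be checked at the two ends.\<close>

lemma xlog_linear_interpolation:
  fixes \<alpha> \<beta> :: real
  assumes "0 \<le> a" "a \<le> u" "u \<le> b" "0 \<le> c"
    and "xlog a + \<alpha> * a + \<beta> \<le> xlog (c + a)"
    and "xlog b + \<alpha> * b + \<beta> \<le> xlog (c + b)"
  shows "xlog u + \<alpha> * u + \<beta> \<le> xlog (c + u)"
proof -
  define f where "f u = xlog (c + u) - xlog u - \<alpha> * u - \<beta>" for u
  have "0 \<le> f u"
  proof (rule nonneg_of_deriv_antimono[where f = f and a = a and b = b
          and f' = "\<lambda>u. log 2 (c + u) - log 2 u - \<alpha>"])
    show "continuous_on {a..b} f"
      unfolding f_def by (intro continuous_intros) (use assms in auto)
    show "(f has_real_derivative log 2 (c + x) - log 2 x - \<alpha>) (at x)" if "a < x" "x < b" for x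
      unfolding f_def using that assms
      by (auto intro!: derivative_eq_intros DERIV_xlog)
    show "log 2 (c + w) - log 2 w - \<alpha> \<le> log 2 (c + v) - log 2 v - \<alpha>"
      if "a < v" "v \<le> w" "w < b" for v w
    proof -
      have "c * v \<le> c * w" using that assms by (intro mult_left_mono) auto
      then have "log 2 ((c + w) / w) \<le> log 2 ((c + v) / v)"
        using that assms by (subst log_le_cancel_iff) (auto simp: field_simps add_pos_nonneg)
      moreover have "v > 0" "w > 0" "c + v > 0" "c + w > 0" using that assms by auto
      ultimately show ?thesis by (simp add: log_divide)
    qed
  qed (use assms in \<open>auto simp: f_def\<close>)
  then show ?thesis by (simp add: f_def)
qed

text \<open>
  Here \<open>u\<close> is the density of the smaller half and \<open>1 - t\<close> that of the larger one. The right-hand side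
  minus the left-hand side vanishes at the points \<open>(u, t) = (0, 0), (0, 1/2), (1/4, 1/4), (1/2, 1/2)\<close>.
  It is concave in \<open>u\<close> on either side of the line \<open>u + t = 1/2\<close>, where the minimum switches, so it
  suffices to check \<open>u = 0\<close>, \<open>u = t\<close> and \<open>u = 1/2 - t\<close>.
\<close>
lemma xlog_large_part:
  assumes "0 \<le> u" "u \<le> t" "t \<le> 1/2"
  shows "xlog u + xlog t + 2 * u + min (2 * u) (1 - 2 * t) \<le> xlog (1 + u - t)"
proof -
  have edge: "xlog (1/2 - t) + xlog t + 4 * (1/2 - t) \<le> xlog (1 - t + (1/2 - t))" if "t \<ge> 1/4"
    using xlog_add_half_le[of "1/2 - t"] that assms by (simp add: algebra_simps)
  have diag: "2 * xlog t + 4 * t \<le> 0" if "t \<le> 1/4"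
  proof (cases "t = 0")
    case False
    then have "log 2 t \<le> log 2 (1/4)" using that assms by (subst log_le_cancel_iff) auto
    also have "\<dots> = -2" using xlog_simps(4) unfolding xlog_def by linarith
    finally have "t * (log 2 t + 2) \<le> 0" using assms by (intro mult_nonneg_nonpos) auto
    then show ?thesis by (simp add: xlog_def algebra_simps)
  qed auto
  show ?thesis
  proof (cases "u + t \<le> 1/2")
    case True
    have "xlog u + 4 * u + xlog t \<le> xlog (1 - t + u)"
    \<comment> \<open>The largest admissible \<open>u\<close> is \<open>t\<close> in the first case
      and \<open>1/2 - t\<close> in the second.\<close>
    proof (cases "t \<le> 1/4")
      case True
      show ?thesis
        by (rule xlog_linear_interpolation[where a = 0 and b = t])
          (use assms diag[OF True] xlog_le_xlog_one_minus[of t] in auto)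
    next
      case False
      show ?thesis
        by (rule xlog_linear_interpolation[where a = 0 and b = "1/2 - t"])
          (use assms edge False \<open>u + t \<le> 1/2\<close> xlog_le_xlog_one_minus[of t] in auto)
    qed
    then show ?thesis by (simp add: algebra_simps)
  next
    case False
    \<comment> \<open>The minimum is now \<open>1 - 2 * t\<close>. At the end \<open>u = t\<close>
      the claim becomes \<open>2 * xlog t + 1 \<le> 0\<close>; here \<open>t > 1/4\<close> because
      \<open>u \<le> t\<close> and \<open>u + t > 1/2\<close>.\<close>
    have "xlog u + 2 * u + (xlog t + 1 - 2 * t) \<le> xlog (1 - t + u)"
      by (rule xlog_linear_interpolation[where a = "1/2 - t" and b = t])
        (use assms edge False xlog_le_neg_half[of t] in auto)
    then show ?thesis by (simp add: algebra_simps)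
  qed
qed

section \<open>Degree sums in the folded cube\<close>

text \<open>\<open>internal_degree V B\<close> counts ordered pairs, i.e. each internal edge twice.\<close>

definition internal_degree :: "'a set \<Rightarrow> 'a set set \<Rightarrow> nat" where
  "internal_degree V B = (\<Sum>i\<in>V. card {x \<in> B. sym_diff x {i} \<in> B})"

text \<open>The contribution of the antipodal matching: added to \<open>internal_degree V B\<close>,
  it gives the degree sum of \<open>B\<close> in the folded cube, each matched pair being counted
  from both ends.\<close>

definition antipodal_count :: "'a set \<Rightarrow> 'a set set \<Rightarrow> nat" where
  "antipodal_count V B = card {x \<in> B. V - x \<in> B}"

lemma card_filter_compl:
  assumes "finite X"
  shows "card {x \<in> X. R x} + card {x \<in> X. \<not> R x} = card X"
proof -
  have "card ({x \<in> X. R x} \<union> {x \<in> X. \<not> R x}) = card {x \<in> X. R x} + card {x \<in> X. \<not> R x}"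
    using assms by (intro card_Un_disjoint) auto
  moreover have "{x \<in> X. R x} \<union> {x \<in> X. \<not> R x} = X" by auto
  ultimately show ?thesis by simp
qed

text \<open>The involution exchanges the points of \<open>B\<close> sent outside \<open>B\<close>
  with the points outside \<open>B\<close> sent into it, so both sides have equally many crossing
  points.\<close>

lemma card_involution_compl:
  assumes "finite U" "B \<subseteq> U"
    and \<sigma>: "\<And>x. x \<in> U \<Longrightarrow> \<sigma> x \<in> U" "\<And>x. x \<in> U \<Longrightarrow> \<sigma> (\<sigma> x) = x"
  shows "card {x \<in> B. \<sigma> x \<in> B} + card (U - B) = card {x \<in> U - B. \<sigma> x \<in> U - B} + card B"
proof -
  have fin: "finite B" "finite (U - B)" using assms finite_subset by auto
  have "bij_betw \<sigma> {x \<in> B. \<sigma> x \<notin> B} {x \<in> U - B. \<sigma> x \<notin> U - B}"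
    by (rule bij_betw_byWitness[where f' = \<sigma>]) (use assms in auto)
  then have "card {x \<in> B. \<sigma> x \<notin> B} = card {x \<in> U - B. \<sigma> x \<notin> U - B}"
    by (rule bij_betw_same_card)
  then show ?thesis
    using card_filter_compl[OF fin(1), of "\<lambda>x. \<sigma> x \<in> B"]
      card_filter_compl[OF fin(2), of "\<lambda>x. \<sigma> x \<in> U - B"] by linarith
qed

text \<open>Regularity of the folded cube: \<open>card_involution_compl\<close> is summed over the
  \<open>card V\<close> coordinate flips and the antipodal map. The additive form avoids subtraction
  on naturals.\<close>

lemma degree_compl:
  fixes V :: "'a set"
  assumes "finite V" "B \<subseteq> Pow V"
  defines "C \<equiv> Pow V - B"
  shows "internal_degree V B + antipodal_count V B + (card V + 1) * card C
    = internal_degree V C + antipodal_count V C + (card V + 1) * card B"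
proof -
  have "finite (Pow V)" using assms by simp
  note compl = card_involution_compl[OF this assms(2), folded C_def]
  have "(\<Sum>i\<in>V. card {x \<in> B. sym_diff x {i} \<in> B} + card C)
      = (\<Sum>i\<in>V. card {x \<in> C. sym_diff x {i} \<in> C} + card B)"
    by (intro sum.cong refl compl) auto
  moreover have "card {x \<in> B. V - x \<in> B} + card C = card {x \<in> C. V - x \<in> C} + card B"
    by (intro compl) auto
  ultimately show ?thesis
    by (simp add: internal_degree_def antipodal_count_def sum.distrib)
qed

lemma antipode_image_card:
  assumes "B \<subseteq> Pow V"
  shows "card ((-) V ` B) = card B"
proof (intro card_image inj_on_inverseI)
  show "V - (V - x) = x" if "x \<in> B" for x using that assms by auto
qed

lemma antipode_image_Int:
  assumes "B \<subseteq> Pow V"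
  shows "B \<inter> (-) V ` B = {x \<in> B. V - x \<in> B}"
proof
  show "{x \<in> B. V - x \<in> B} \<subseteq> B \<inter> (-) V ` B"
  proof
    fix x assume x: "x \<in> {x \<in> B. V - x \<in> B}"
    then have "x = V - (V - x)" using assms by auto
    with x show "x \<in> B \<inter> (-) V ` B" by blast
  qed
  show "B \<inter> (-) V ` B \<subseteq> {x \<in> B. V - x \<in> B}"
  proof
    fix x assume x: "x \<in> B \<inter> (-) V ` B"
    then obtain y where "y \<in> B" "x = V - y" by blast
    moreover then have "V - x = y" using assms by auto
    ultimately show "x \<in> {x \<in> B. V - x \<in> B}" using x by simp
  qed
qed

text \<open>Inclusion-exclusion for \<open>B\<close> and its antipodal image, two sets of equal size
  inside \<open>Pow V\<close>.\<close>

lemma antipodal_count_ge: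
  assumes "finite V" "B \<subseteq> Pow V"
  shows "2 * card B \<le> 2 ^ card V + antipodal_count V B"
proof -
  have fin: "finite B" using assms by (meson finite_Pow_iff finite_subset)
  have "card B + card ((-) V ` B) = card (B \<union> (-) V ` B) + card (B \<inter> (-) V ` B)"
    using fin by (intro card_Un_Int) auto
  moreover have "card (B \<union> (-) V ` B) \<le> card (Pow V)"
    using assms by (intro card_mono) auto
  ultimately show ?thesis using assms
    by (simp add: antipode_image_card antipode_image_Int antipodal_count_def card_Pow)
qed

section \<open>Splitting a family along one coordinate\<close>

lemma card_split:
  assumes "finite V" "a \<notin> V" "B \<subseteq> Pow (insert a V)"
  shows "card B = card {x \<in> B. a \<notin> x} + card {x \<in> Pow V. insert a x \<in> B}"
proof -
  have fin: "finite B" using assms by (meson finite_Pow_iff finite_insert finite_subset)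
  have "insert a ` {x \<in> Pow V. insert a x \<in> B} = {x \<in> B. a \<in> x}" (is "?l = ?r")
  proof
    show "?r \<subseteq> ?l"
    proof
      fix x assume "x \<in> ?r"
      then show "x \<in> ?l" using assms
        by (intro image_eqI[of _ _ "x - {a}"]) (auto simp: insert_absorb)
    qed
  qed auto
  moreover have "inj_on (insert a) {x \<in> Pow V. insert a x \<in> B}"
    using assms(2) by (auto simp: inj_on_def)
  then have "card (insert a ` {x \<in> Pow V. insert a x \<in> B}) = card {x \<in> Pow V. insert a x \<in> B}"
    by (rule card_image)
  ultimately have "card {x \<in> Pow V. insert a x \<in> B} = card {x \<in> B. a \<in> x}" by simp
  then show ?thesis using card_filter_compl[OF fin, of "\<lambda>x. a \<in> x"] by simp
qed

lemma card_antipode_swap: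
  assumes "P \<subseteq> Pow V" "Q \<subseteq> Pow V"
  shows "card {x \<in> P. V - x \<in> Q} = card {x \<in> Q. V - x \<in> P}"
proof (rule bij_betw_same_card)
  show "bij_betw ((-) V) {x \<in> P. V - x \<in> Q} {x \<in> Q. V - x \<in> P}"
    by (rule bij_betw_byWitness[where f' = "(-) V"]) (use assms in \<open>auto simp: double_diff subset_iff\<close>)
qed

text \<open>Edges in direction \<open>a\<close> correspond to \<open>P \<inter> Q\<close>. The
  antipodal map of the larger cube also flips \<open>a\<close>, so it only pairs one half with the
  other. Removing \<open>a\<close> from the upper half puts both halves in \<open>Pow V\<close>,
  ready for induction.\<close>

lemma degree_split:
  fixes V :: "'a set"
  assumes V: "finite V" "a \<notin> V" and B: "B \<subseteq> Pow (insert a V)"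
  defines "P \<equiv> {x \<in> B. a \<notin> x}" and "Q \<equiv> {x \<in> Pow V. insert a x \<in> B}"
  shows "internal_degree (insert a V) B
      = internal_degree V P + internal_degree V Q + 2 * card (P \<inter> Q)"
    and "antipodal_count (insert a V) B = 2 * card {x \<in> P. V - x \<in> Q}"
proof -
  have PV: "P \<subseteq> Pow V" and QV: "Q \<subseteq> Pow V" using B by (auto simp: P_def Q_def)
  have split: "card {x \<in> B. R x} = card {x \<in> P. R x} + card {x \<in> Q. R (insert a x)}" for R
  proof -
    have "{x \<in> B. R x} \<subseteq> Pow (insert a V)" using B by auto
    moreover have "{x \<in> {x \<in> B. R x}. a \<notin> x} = {x \<in> P. R x}"
      "{x \<in> Pow V. insert a x \<in> {x \<in> B. R x}} = {x \<in> Q. R (insert a x)}"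
      by (auto simp: P_def Q_def)
    ultimately show ?thesis using card_split[OF V, of "{x \<in> B. R x}"] by simp
  qed
  have old: "card {x \<in> B. sym_diff x {i} \<in> B}
      = card {x \<in> P. sym_diff x {i} \<in> P} + card {x \<in> Q. sym_diff x {i} \<in> Q}" if "i \<in> V" for i
  proof -
    have "i \<noteq> a" using that V by auto
    then have "{x \<in> P. sym_diff x {i} \<in> B} = {x \<in> P. sym_diff x {i} \<in> P}"
      and "sym_diff (insert a x) {i} = insert a (sym_diff x {i})" for x
      by (auto simp: P_def)
    moreover from this(2)
    have "{x \<in> Q. sym_diff (insert a x) {i} \<in> B} = {x \<in> Q. sym_diff x {i} \<in> Q}"
      using that by (auto simp: Q_def)
    ultimately show ?thesis unfolding split by simp
  qed
  have "{x \<in> P. sym_diff x {a} \<in> B} = P \<inter> Q"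
    using PV by (auto simp: P_def Q_def)
  moreover have "{x \<in> Q. sym_diff (insert a x) {a} \<in> B} = P \<inter> Q"
  proof -
    have "sym_diff (insert a x) {a} = x" if "x \<in> Q" for x
      using that V(2) QV by auto
    then show ?thesis using QV V(2) by (auto simp: P_def)
  qed
  ultimately have "card {x \<in> B. sym_diff x {a} \<in> B} = 2 * card (P \<inter> Q)"
    unfolding split by simp
  then show "internal_degree (insert a V) B
      = internal_degree V P + internal_degree V Q + 2 * card (P \<inter> Q)"
    using V old by (simp add: internal_degree_def sum.distrib)
  have "{x \<in> P. insert a V - x \<in> B} = {x \<in> P. V - x \<in> Q}"
    by (auto simp: P_def Q_def insert_Diff_if)
  moreover have "{x \<in> Q. insert a V - insert a x \<in> B} = {x \<in> Q. V - x \<in> P}"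
    using V(2) by (auto simp: P_def)
  ultimately show "antipodal_count (insert a V) B = 2 * card {x \<in> P. V - x \<in> Q}"
    unfolding antipodal_count_def split using card_antipode_swap[OF PV QV] by simp
qed

text \<open>A point of \<open>P\<close> counted on the left in both ways lies in \<open>R\<close>.
  The union of \<open>R\<close> and its antipodal image lies in \<open>E\<close>, and their
  intersection consists of points of \<open>P\<close> with antipode in \<open>P\<close>; so
  \<open>2 * card R\<close> is at most the two antipodal counts together.\<close>

lemma cross_count_le:
  assumes "finite V" "P \<subseteq> Pow V" "Q \<subseteq> Pow V"
  shows "2 * card (P \<inter> Q) + 2 * card {x \<in> P. V - x \<in> Q}
    \<le> antipodal_count V P + antipodal_count V Q + 2 * card P"
proof -
  define E R where "E = {x \<in> Q. V - x \<in> Q}" and "R = P \<inter> E"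
  have fin: "finite P" "finite Q" using assms by (meson finite_Pow_iff finite_subset)+
  then have finER: "finite E" "finite R" by (auto simp: E_def R_def)
  have RV: "R \<subseteq> Pow V" using assms by (auto simp: R_def)
  have "card (P \<inter> Q) + card {x \<in> P. V - x \<in> Q}
      = card (P \<inter> Q \<union> {x \<in> P. V - x \<in> Q}) + card (P \<inter> Q \<inter> {x \<in> P. V - x \<in> Q})"
    using fin by (intro card_Un_Int) auto
  also have "P \<inter> Q \<inter> {x \<in> P. V - x \<in> Q} = R" by (auto simp: R_def E_def)
  also have "card (P \<inter> Q \<union> {x \<in> P. V - x \<in> Q}) \<le> card P"
    using fin by (intro card_mono) auto
  finally have 1: "card (P \<inter> Q) + card {x \<in> P. V - x \<in> Q} \<le> card P + card R" by simp
  have "2 * card R = card (R \<union> (-) V ` R) + card (R \<inter> (-) V ` R)"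
    using card_Un_Int[of R "(-) V ` R"] finER antipode_image_card[OF RV] by simp
  also have "card (R \<union> (-) V ` R) \<le> card E"
    using finER assms by (intro card_mono) (auto simp: R_def E_def double_diff subset_iff)
  also have "card (R \<inter> (-) V ` R) \<le> card {x \<in> P. V - x \<in> P}"
    unfolding antipode_image_Int[OF RV] using fin by (intro card_mono) (auto simp: R_def)
  finally show ?thesis using 1 by (simp add: antipodal_count_def E_def)
qed

section \<open>Edge boundary and internal degree\<close>

text \<open>A boundary edge is determined by its unique end in \<open>A\<close> and its direction.
  Each of the \<open>n\<close> directions at a vertex of \<open>A\<close> leads either inside or
  outside \<open>A\<close>.\<close>

lemma card_edge_boundary:
  assumes "A \<subseteq> cube_vertices n"
  shows "card (edge_boundary n A) + internal_degree {1..n} A = n * card A"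
proof -
  have finA: "finite A" using assms unfolding cube_vertices_def
    by (meson finite_Pow_iff finite_atLeastAtMost finite_subset)
  define S where "S = (SIGMA i:{1..n}. {x \<in> A. sym_diff x {i} \<notin> A})"
  define f :: "nat \<times> nat set \<Rightarrow> nat set set" where "f = (\<lambda>(i, x). {x, sym_diff x {i}})"
  have "edge_boundary n A = f ` S"
  proof
    show "edge_boundary n A \<subseteq> f ` S"
    proof
      fix e assume "e \<in> edge_boundary n A"
      then have "e \<in> cube_edges n" "\<exists>x y. e = {x, y} \<and> x \<in> A \<and> y \<notin> A"
        by (simp_all add: edge_boundary_def)
      then obtain x y x' y' where e: "e = {x, y}" "x \<in> A" "y \<notin> A" and e': "e = {x', y'}"
        "x' \<in> cube_vertices n" "y' \<in> cube_vertices n" "card (sym_diff x' y') = 1"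
        unfolding cube_edges_def by (elim exE conjE CollectE)
      have "sym_diff x y = sym_diff x' y'" "x \<subseteq> {1..n}" "y \<subseteq> {1..n}"
        using e e' by (auto simp: doubleton_eq_iff cube_vertices_def)
      with e' obtain i where i: "sym_diff x y = {i}" by (metis card_1_singletonE)
      then have "y = sym_diff x {i}" "i \<in> {1..n}"
        using \<open>x \<subseteq> {1..n}\<close> \<open>y \<subseteq> {1..n}\<close> by blast+
      then show "e \<in> f ` S" using e
        by (intro image_eqI[of _ _ "(i, x)"]) (auto simp: f_def S_def)
    qed
    show "f ` S \<subseteq> edge_boundary n A"
    proof
      fix e assume "e \<in> f ` S"
      then obtain i x where ix: "i \<in> {1..n}" "x \<in> A" "sym_diff x {i} \<notin> A" "e = {x, sym_diff x {i}}"
        by (auto simp: f_def S_def)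
      moreover have "sym_diff x (sym_diff x {i}) = {i}" by auto
      then have "card (sym_diff x (sym_diff x {i})) = 1" by simp
      moreover have "x \<in> cube_vertices n" "sym_diff x {i} \<in> cube_vertices n"
        using ix assms by (auto simp: cube_vertices_def)
      ultimately show "e \<in> edge_boundary n A"
        unfolding edge_boundary_def cube_edges_def using ix(2-4) by (intro CollectI conjI exI)
    qed
  qed
  moreover have "inj_on f S"
  proof (rule inj_onI)
    fix p q assume pq: "p \<in> S" "q \<in> S" "f p = f q"
    obtain i x j y where p: "p = (i, x)" and q: "q = (j, y)" by (cases p, cases q)
    have "x \<in> A" "y \<in> A" "sym_diff x {i} \<notin> A" "sym_diff y {j} \<notin> A"
      "{x, sym_diff x {i}} = {y, sym_diff y {j}}"
      using pq by (simp_all add: p q S_def f_def)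
    then have "x = y" "sym_diff x {i} = sym_diff y {j}"
      by (metis doubleton_eq_iff)+
    then have "x = y" "i = j" by blast+
    then show "p = q" by (simp add: p q)
  qed
  ultimately have "card (edge_boundary n A) = card S" by (simp add: card_image)
  also have "\<dots> = (\<Sum>i\<in>{1..n}. card {x \<in> A. sym_diff x {i} \<notin> A})"
    unfolding S_def using finA by (subst card_SigmaI) auto
  finally have "card (edge_boundary n A) + internal_degree {1..n} A
      = (\<Sum>i\<in>{1..n}. card {x \<in> A. sym_diff x {i} \<in> A} + card {x \<in> A. sym_diff x {i} \<notin> A})"
    by (simp add: internal_degree_def sum.distrib)
  also have "\<dots> = (\<Sum>i\<in>{1..n}. card A)"
    by (intro sum.cong refl card_filter_compl finA)
  finally show ?thesis by simp
qed

section \<open>The isoperimetric inequality\<close>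

text \<open>The induction step, with the halves ordered by size. The larger half may exceed half of
  its cube, where \<open>IH\<close> does not apply; its complement is used instead.\<close>

lemma degree_split_le:
  fixes V :: "'a set"
  assumes V: "finite V" and P: "P \<subseteq> Pow V" and Q: "Q \<subseteq> Pow V"
    and le: "card P \<le> card Q" and small: "card P + card Q \<le> 2 ^ card V"
    and IH: "\<And>B. B \<subseteq> Pow V \<Longrightarrow> 2 * card B \<le> 2 ^ card V \<Longrightarrow>
      real (internal_degree V B + antipodal_count V B) \<le> xlog (card B)"
  shows "real (internal_degree V P + internal_degree V Q + 2 * card (P \<inter> Q)
      + 2 * card {x \<in> P. V - x \<in> Q}) \<le> xlog (card P + card Q)"
    (is "real ?F \<le> _")
proof -
  have finP: "finite P" using P V by (meson finite_Pow_iff finite_subset)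
  note cross = cross_count_le[OF V P Q]
  have IHP: "real (internal_degree V P + antipodal_count V P) \<le> xlog (card P)"
    using P le small by (intro IH) auto
  show ?thesis
  proof (cases "2 * card Q \<le> 2 ^ card V")
    case True
    then have "real (internal_degree V Q + antipodal_count V Q) \<le> xlog (card Q)"
      by (intro IH Q)
    moreover have "xlog (card P) + xlog (card Q) + 2 * card P \<le> xlog (card P + card Q)"
      using xlog_add_ge[of "card P" "card Q"] le by simp
    moreover have "real ?F \<le> real (internal_degree V P + antipodal_count V P)
        + real (internal_degree V Q + antipodal_count V Q) + 2 * card P"
      using cross by linarith
    ultimately show ?thesis using IHP by linarith
  next
    case False
    define m and N :: real and C where "m = card V" and "N = 2 ^ m" and "C = Pow V - Q"
    have N: "N > 0" by (simp add: N_def)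
    have "finite (Pow V)" using V by simp
    then have "card C + card Q = 2 ^ m"
      using Q card_Diff_subset[of Q "Pow V"] card_mono[of "Pow V" Q]
      by (simp add: C_def m_def card_Pow finite_subset)
    then have cardC: "real (card C) = N - card Q"
      unfolding N_def by (simp flip: of_nat_eq_iff[where 'a = real])
    have Q_large: "N < 2 * real (card Q)"
      using False by (simp add: N_def m_def not_le flip: of_nat_less_iff[where 'a = real])
    have PQ: "real (card P) + real (card Q) \<le> N"
      using small by (simp add: N_def m_def flip: of_nat_le_iff[where 'a = real])
    have "2 * card C \<le> 2 ^ card V"
      using \<open>card C + card Q = 2 ^ m\<close> False unfolding m_def by linarith
    then have "real (internal_degree V C + antipodal_count V C) \<le> xlog (card C)"
      by (intro IH) (auto simp: C_def)
    moreover have "real (internal_degree V Q + antipodal_count V Q + (m + 1) * card C)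
        = real (internal_degree V C + antipodal_count V C + (m + 1) * card Q)"
      using degree_compl[OF V Q] unfolding C_def m_def by (rule arg_cong)
    then have "real (internal_degree V Q + antipodal_count V Q)
        = real (internal_degree V C + antipodal_count V C) + (real m + 1) * (2 * card Q - N)"
      using cardC by (simp add: algebra_simps)
    ultimately have Q_bound: "real (internal_degree V Q + antipodal_count V Q)
        \<le> xlog (card C) + (real m + 1) * (2 * card Q - N)"
      by linarith
    have "real (2 * card Q) \<le> real (2 ^ card V + antipodal_count V Q)"
      using antipodal_count_ge[OF V Q] by (rule of_nat_mono)
    then have anti: "2 * real (card Q) - N \<le> antipodal_count V Q"
      by (simp add: N_def m_def)
    have "card (P \<inter> Q) \<le> card P" "card {x \<in> P. V - x \<in> Q} \<le> card P"
      using finP by (auto intro: card_mono)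
    \<comment> \<open>The term 0 in the minimum comes from \<open>cross\<close>; the other comes
      from bounding both cross counts by \<open>card P\<close> and dropping the antipodal count of
      \<open>P\<close>.\<close>
    then have "real ?F \<le> real (internal_degree V P + antipodal_count V P)
        + real (internal_degree V Q + antipodal_count V Q) + 2 * card P
        + min 0 (2 * card P - real (antipodal_count V Q))"
      using cross by (simp add: min_def)
    \<comment> \<open>One of the \<open>m + 1\<close> copies of \<open>2 * card Q - N\<close> moves
      into the minimum, where \<open>anti\<close> cancels it against the antipodal count of
      \<open>Q\<close>.\<close>
    also have "\<dots> \<le> xlog (card P) + xlog (card C) + real m * (2 * card Q - N) + 2 * card P
        + min (2 * card P) (2 * card Q - N)"
      using IHP Q_bound anti by (simp add: algebra_simps min_def)
    also have "\<dots> \<le> xlog (card P + card Q)"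
    proof -
      define u t where "u = card P / N" and "t = card C / N"
      \<comment> \<open>The terms linear in \<open>m\<close> cancel after scaling, because
        \<open>u + t + (1 - 2 * t) = 1 + u - t\<close>; what remains is \<open>N\<close> times
        \<open>xlog_large_part\<close>.\<close>
      have scale: "xlog (N * x) = N * xlog x + x * (N * m)" if "x \<ge> 0" for x
        using xlog_mult[OF that N] by (simp add: xlog_def N_def log_nat_power)
      have ut: "0 \<le> u" "u \<le> t" "t \<le> 1/2"
        using N cardC PQ Q_large by (auto simp: u_def t_def field_simps)
      have eqs: "card P = N * u" "card C = N * t" "card Q = N * (1 - t)"
        using N cardC by (auto simp: u_def t_def field_simps)
      have "N * (xlog u + xlog t + 2 * u + min (2 * u) (1 - 2 * t)) \<le> N * xlog (1 + u - t)"
        using xlog_large_part[OF ut] N by (intro mult_left_mono) auto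
      moreover have "N * min (2 * u) (1 - 2 * t) = min (2 * (N * u)) (2 * (N * (1 - t)) - N)"
        using N by (simp add: min_mult_distrib_left algebra_simps)
      moreover have "N * u + N * (1 - t) = N * (1 + u - t)" by (simp add: algebra_simps)
      ultimately show ?thesis
        unfolding of_nat_add of_nat_mult of_nat_numeral eqs
        using ut scale[of u] scale[of t] scale[of "1 + u - t"]
        by (simp add: algebra_simps)
    qed
    finally show ?thesis .
  qed
qed

text \<open>The size restriction cannot be dropped: the whole cube has degree sum
  \<open>(card V + 1) * 2 ^ card V\<close>. Subcubes of dimension below \<open>card V\<close> attain
  equality.\<close>

theorem degree_le_xlog:
  fixes V :: "'a set"
  assumes "finite V" "B \<subseteq> Pow V" "2 * card B \<le> 2 ^ card V"
  shows "real (internal_degree V B + antipodal_count V B) \<le> xlog (card B)"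
  using assms
proof (induction V arbitrary: B rule: finite_induct)
  case empty
  \<comment> \<open>For empty \<open>V\<close> the size bound reads
    \<open>2 * card B \<le> 1\<close>.\<close>
  then have "card B = 0" by simp
  moreover have "finite B" using empty by (auto intro: finite_subset)
  ultimately show ?case by (simp add: internal_degree_def antipodal_count_def)
next
  case (insert a V)
  define P Q where "P = {x \<in> B. a \<notin> x}" and "Q = {x \<in> Pow V. insert a x \<in> B}"
  have PQ: "P \<subseteq> Pow V" "Q \<subseteq> Pow V" using insert.prems by (auto simp: P_def Q_def)
  have card: "card B = card P + card Q"
    unfolding P_def Q_def by (rule card_split) (use insert in auto)
  then have small: "card P + card Q \<le> 2 ^ card V" "card Q + card P \<le> 2 ^ card V"
    using insert by simp_all
  have split: "internal_degree (insert a V) B + antipodal_count (insert a V) B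
      = internal_degree V P + internal_degree V Q + 2 * card (P \<inter> Q)
        + 2 * card {x \<in> P. V - x \<in> Q}"
    unfolding P_def Q_def using degree_split[OF insert.hyps insert.prems(1)] by simp
  show ?case
  proof (cases "card P \<le> card Q")
    case True
    show ?thesis
      using degree_split_le[OF insert.hyps(1) PQ True small(1) insert.IH]
      unfolding split card by simp
  next
    case False
    then have "card Q \<le> card P" by simp
    from degree_split_le[OF insert.hyps(1) PQ(2,1) this small(2) insert.IH]
    show ?thesis
      unfolding split card card_antipode_swap[OF PQ] by (simp add: Int_commute add_ac)
  qed
qed

section \<open>Antipodal families and the extremal example\<close>

text \<open>The halves along coordinate \<open>n\<close> are antipodal images of each other, of size
  \<open>2 ^ (k - 1)\<close> each. The assumption \<open>k \<le> n - 1\<close> makes them small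
  enough for \<open>degree_le_xlog\<close>.\<close>

lemma internal_degree_antipodal_le:
  assumes n: "n \<ge> 1" and k: "k \<in> {1..n - 1}" and A: "A \<subseteq> Pow {1..n}"
    and anti: "\<And>x. x \<in> A \<Longrightarrow> {1..n} - x \<in> A" and card: "card A = 2 ^ k"
  shows "internal_degree {1..n} A \<le> (k - 1) * 2 ^ k"
proof -
  define V P Q where "V = {1..n - 1}" and "P = {x \<in> A. n \<notin> x}"
    and "Q = {x \<in> Pow V. insert n x \<in> A}"
  have nV: "{1..n} = insert n V" "n \<notin> V" and V: "finite V"
    using n by (auto simp: V_def)
  have A': "A \<subseteq> Pow (insert n V)" using A nV by simp
  have PV: "P \<subseteq> Pow V" and QV: "Q \<subseteq> Pow V" using A' by (auto simp: P_def Q_def)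
  have PQ: "V - x \<in> Q" if "x \<in> P" for x
  proof -
    have "{1..n} - x = insert n (V - x)" using that nV by (auto simp: P_def)
    then show ?thesis using anti[of x] that by (auto simp: P_def Q_def)
  qed
  have QP: "V - x \<in> P" if "x \<in> Q" for x
  proof -
    have "{1..n} - insert n x = V - x" using nV by auto
    then show ?thesis using anti[of "insert n x"] that nV(2) by (auto simp: P_def Q_def)
  qed
  have "{x \<in> P. V - x \<in> Q} = P" "{x \<in> Q. V - x \<in> P} = Q" using PQ QP by auto
  then have eq: "card P = card Q" using card_antipode_swap[OF PV QV] by simp
  have "card A = card P + card Q"
    unfolding P_def Q_def by (rule card_split[OF V nV(2) A'])
  with card eq k have cards: "card P = 2 ^ (k - 1)" "card Q = 2 ^ (k - 1)"
    by (cases k; simp)+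
  have "(2::nat) * 2 ^ (k - 1) = 2 ^ k" using k by (cases k) auto
  also have "\<dots> \<le> 2 ^ card V" using k by (intro power_increasing) (auto simp: V_def)
  finally have small: "2 * (2::nat) ^ (k - 1) \<le> 2 ^ card V" .
  have xl: "xlog (real (2 ^ (k - 1))) = real ((k - 1) * 2 ^ (k - 1))"
    by (simp add: xlog_def log_nat_power)
  have "internal_degree V P + antipodal_count V P \<le> (k - 1) * 2 ^ (k - 1)"
    using degree_le_xlog[OF V PV] small unfolding cards xl of_nat_le_iff by simp
  moreover have "internal_degree V Q + antipodal_count V Q \<le> (k - 1) * 2 ^ (k - 1)"
    using degree_le_xlog[OF V QV] small unfolding cards xl of_nat_le_iff by simp
  \<comment> \<open>Edges in direction \<open>n\<close> thus become antipodal pairs within each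
    half, so the internal degree of \<open>A\<close> is the sum of the two folded degree
    sums.\<close>
  moreover have "{x \<in> P. V - x \<in> P} = P \<inter> Q" "{x \<in> Q. V - x \<in> Q} = P \<inter> Q"
  proof -
    have "V - (V - x) = x" if "x \<in> P \<or> x \<in> Q" for x using that PV QV by auto
    then show "{x \<in> P. V - x \<in> P} = P \<inter> Q" "{x \<in> Q. V - x \<in> Q} = P \<inter> Q"
      using PQ QP by fastforce+
  qed
  then have "antipodal_count V P = card (P \<inter> Q)" "antipodal_count V Q = card (P \<inter> Q)"
    by (simp_all add: antipodal_count_def)
  moreover have "internal_degree {1..n} A
      = internal_degree V P + internal_degree V Q + 2 * card (P \<inter> Q)"
    unfolding nV(1) P_def Q_def by (rule degree_split[OF V nV(2) A'])
  moreover have "(k - 1) * 2 ^ k = 2 * ((k - 1) * 2 ^ (k - 1))" using k by (cases k) auto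
  ultimately show ?thesis by linarith
qed

text \<open>Both subcubes are closed under flipping the first \<open>j\<close> coordinates, and
  coordinate \<open>n\<close> separates them because \<open>j < n\<close>. A lower bound on the
  degree is an upper bound on the boundary.\<close>

lemma internal_degree_subcubes_ge:
  assumes "j < n"
  defines "D \<equiv> subcube n j \<union> antipode n ` subcube n j"
  shows "D \<subseteq> cube_vertices n" "card D = 2 * 2 ^ j" "j * card D \<le> internal_degree {1..n} D"
proof -
  have S: "subcube n j = Pow {1..j}" using assms by (auto simp: subcube_def)
  then have fin: "finite (subcube n j)" by simp
  show "D \<subseteq> cube_vertices n"
    by (auto simp: D_def subcube_def antipode_def cube_vertices_def)
  have "card (antipode n ` subcube n j) = 2 ^ j"
  proof -
    have "subcube n j \<subseteq> Pow {1..n}" by (auto simp: subcube_def)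
    from antipode_image_card[OF this] show ?thesis
      by (simp add: antipode_def[abs_def] S card_Pow)
  qed
  moreover have "n \<in> antipode n x" "n \<notin> x" if "x \<in> subcube n j" for x
    using that assms by (auto simp: S antipode_def)
  then have "subcube n j \<inter> antipode n ` subcube n j = {}" by blast
  ultimately show "card D = 2 * 2 ^ j"
    using fin unfolding D_def by (subst card_Un_disjoint) (auto simp: S card_Pow)
  have "{x \<in> D. sym_diff x {i} \<in> D} = D" if i: "i \<in> {1..j}" for i
  proof -
    have stable: "sym_diff x {i} \<in> subcube n j" if "x \<in> subcube n j" for x
      using that i by (auto simp: S)
    have "sym_diff (antipode n x) {i} = antipode n (sym_diff x {i})" for x
      using i assms by (auto simp: antipode_def)
    with stable show ?thesis by (auto simp: D_def)
  qed
  then have "j * card D = (\<Sum>i\<in>{1..j}. card {x \<in> D. sym_diff x {i} \<in> D})" by simp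
  also have "\<dots> \<le> internal_degree {1..n} D"
    unfolding internal_degree_def using assms by (intro sum_mono2) auto
  finally show "j * card D \<le> internal_degree {1..n} D" .
qed

theorem mainTheorem2:
  fixes n k :: nat and A :: "nat set set"
  assumes "n \<ge> 1"
    and "k \<in> {1..n - 1}"
    and "A \<subseteq> cube_vertices n"
    and "antipodal n A"
    and "card A = 2 ^ k"
  shows "card (edge_boundary n A)
           \<ge> card (edge_boundary n (subcube n (k - 1) \<union> antipode n ` subcube n (k - 1)))"
proof -
  define D where "D = subcube n (k - 1) \<union> antipode n ` subcube n (k - 1)"
  have "k - 1 < n" using assms by auto
  note D = internal_degree_subcubes_ge[OF this, folded D_def]
  have "{1..n} - x \<in> A" if "x \<in> A" for x
    using that assms(4) unfolding antipodal_def antipode_def by blast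
  then have "internal_degree {1..n} A \<le> (k - 1) * 2 ^ k"
    using assms by (intro internal_degree_antipodal_le) (auto simp: cube_vertices_def)
  moreover have "card D = 2 ^ k" using D(2) assms(2) by (cases k) auto
  \<comment> \<open>Each boundary has size \<open>n * 2 ^ k\<close> minus the internal degree, so
    the two degree bounds compare them.\<close>
  ultimately show ?thesis
    using card_edge_boundary[OF assms(3)] card_edge_boundary[OF D(1)] D(3) assms(5)
    unfolding D_def[symmetric] by simp
qed

end
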